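(* Let $n\geq 2$. For any $f\in C_0(\mathbb{Z}^n)$, $$\|f\|_{\frac{n}{n-1}}\leq\frac{1}{2n}\|df\|_1.$$ Moreover, equality holds if and only if $f=\lambda\cdot\chi_Q$ for some $\lambda\in\mathbb{R}$ and some cube $Q$ in $\mathbb{Z}^n$.
   Context: $C_0(\mathbb{Z}^n)$ denotes the space of real-valued functions on $\mathbb{Z}^n$ with finite support. For $p>0$ and $f\in C_0(\mathbb{Z}^n)$, $\|f\|_p:=\left(\sum_{z\in\mathbb{Z}^n}|f(z)|^p\right)^{1/p}$. $\mathbb{Z}^n$ is regarded as a graph with edge set $E(\mathbb{Z}^n)=\{\{z,z+e_i\} : z\in\mathbb{Z}^n,\ i=1,\dots,n\}$, where $e_i\in\mathbb{Z}^n$ is the vector whose $i$-th component is $1$ and whose other components are $0$. The differential of $f$ is $df(x,y)=f(y)-f(x)$ if $\{x,y\}\in E(\mathbb{Z}^n)$ and $0$ otherwise, and $\|df\|_1:=\sum_{\{x,y\}\in E(\mathbb{Z}^n)}|df(x,y)|$, the sum being over unordered edges; equivalently $\|df\|_1=\sum_{i=1}^n\|\partial_i f\|_1$ with $\partial_i f(z)=f(z+e_i)-f(z)$. $\chi_Q$ is the indicator function of $Q$. A cube in $\mathbb{Z}^n$ is a set of the form $Q=\prod_{i=1}^n[a_i,b_i]$ with $a_i,b_i\in\mathbb{Z}$, $a_i\leq b_i$, and $|b_i-a_i|$ independent of $i$, where $[a,b]=\{z\in\mathbb{Z} : a\leq z\leq b\}$. *)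

theory Defs
  imports "HOL-Analysis.Analysis"
begin

text \<open>The lattice of dimension n is the type \<open>int ^ 'n\<close> with n = \<open>CARD('n)\<close>.\<close>

definition C0 :: "(int ^ 'n::finite \<Rightarrow> real) set" where
  "C0 = {f. finite {z. f z \<noteq> 0}}"

definition lp_norm :: "real \<Rightarrow> ('a \<Rightarrow> real) \<Rightarrow> real" where
  "lp_norm p f = (\<Sum>\<^sub>\<infinity>z. \<bar>f z\<bar> powr p) powr (1 / p)"

definition lattice_edges :: "(int ^ 'n::finite) set set" where
  "lattice_edges = {{z, z + axis i 1} | z i. True}"

definition differential :: "(int ^ 'n::finite \<Rightarrow> real) \<Rightarrow> int ^ 'n \<Rightarrow> int ^ 'n \<Rightarrow> real" where
  "differential f x y = (if {x, y} \<in> lattice_edges then f y - f x else 0)"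

text \<open>The sum below runs over unordered edges. The summand at an edge \<open>{x, y}\<close> is
  \<open>\<bar>differential f x y\<bar>\<close>, which does not depend on the order of the two endpoints; see
  \<open>abs_differential_edge_eq\<close>.\<close>

definition abs_differential_edge :: "(int ^ 'n::finite \<Rightarrow> real) \<Rightarrow> (int ^ 'n) set \<Rightarrow> real" where
  "abs_differential_edge f e = (THE r. \<exists>x y. e = {x, y} \<and> r = \<bar>differential f x y\<bar>)"

definition differential_l1_norm :: "(int ^ 'n::finite \<Rightarrow> real) \<Rightarrow> real" where
  "differential_l1_norm f = (\<Sum>\<^sub>\<infinity>e\<in>lattice_edges. abs_differential_edge f e)"

definition is_cube :: "(int ^ 'n::finite) set \<Rightarrow> bool" where
  "is_cube Q \<longleftrightarrow> (\<exists>a b. (\<forall>i. a $ i \<le> b $ i) \<and>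
     (\<forall>i j. \<bar>b $ i - a $ i\<bar> = \<bar>b $ j - a $ j\<bar>) \<and>
     Q = {z. \<forall>i. z $ i \<in> {a $ i..b $ i}})"

lemma abs_differential_edge_eq: "abs_differential_edge f {x, y} = \<bar>differential f x y\<bar>"
  unfolding abs_differential_edge_def
proof (rule the_equality)
  show "\<exists>x' y'. {x, y} = {x', y'} \<and> \<bar>differential f x y\<bar> = \<bar>differential f x' y'\<bar>"
    by blast
  fix r assume "\<exists>x' y'. {x, y} = {x', y'} \<and> r = \<bar>differential f x' y'\<bar>"
  then show "r = \<bar>differential f x y\<bar>"
    by (auto simp: doubleton_eq_iff differential_def insert_commute)
qed

lemma inj_edge: "inj (\<lambda>(z :: int ^ 'n::finite, i). {z, z + axis i 1})"
proof (rule injI, clarify)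
  fix z w :: "int ^ 'n" and i j
  assume "{z, z + axis i 1} = {w, w + axis j 1}"
  then consider "z = w" "z + axis i 1 = w + axis j 1" | "z = w + axis j 1" "z + axis i 1 = w"
    by (auto simp: doubleton_eq_iff)
  then show "z = w \<and> i = j"
  proof cases
    case 1
    then show ?thesis by (auto simp: axis_eq_axis)
  next
    case 2
    then have "axis j 1 + axis i 1 = (0 :: int ^ 'n)"
      by (metis add.assoc add_cancel_left_right)
    then have "axis j 1 $ i + axis i (1::int) $ i = 0"
      by (metis vector_add_component zero_index)
    then show ?thesis by (simp add: axis_def split: if_splits)
  qed
qed

lemma differential_l1_norm_eq_sum_partial:
  fixes f :: "int ^ 'n::finite \<Rightarrow> real"
  assumes "f \<in> C0"
  shows "differential_l1_norm f = (\<Sum>i\<in>UNIV. \<Sum>\<^sub>\<infinity>z. \<bar>f (z + axis i 1) - f z\<bar>)"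
proof -
  let ?h = "\<lambda>(z :: int ^ 'n, i). {z, z + axis i 1}"
  let ?g = "\<lambda>(i, z). \<bar>f (z + axis i 1) - f z\<bar>"
  define S where "S = {z. f z \<noteq> 0}"
  define T where "T = S \<union> (\<Union>i. (\<lambda>z. z - axis i 1) ` S)"
  have T: "finite T" using assms by (auto simp: T_def S_def C0_def)
  have zero: "?g (i, z) = 0" if "z \<notin> T" for i z
  proof -
    have "z \<notin> S" "z + axis i 1 \<notin> S"
      using that by (auto simp: T_def image_iff) (metis add_diff_cancel_right')
    then show ?thesis by (simp add: S_def)
  qed
  then have inT: "z \<in> T" if "f (z + axis i 1) \<noteq> f z" for z i
    using that by force
  have E: "lattice_edges = range ?h"
    by (auto simp: lattice_edges_def)
  have w: "abs_differential_edge f (?h (z, i)) = ?g (i, z)" for z i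
    by (auto simp: abs_differential_edge_eq differential_def lattice_edges_def)
  have "differential_l1_norm f = (\<Sum>\<^sub>\<infinity>(z, i)\<in>UNIV. abs_differential_edge f (?h (z, i)))"
    unfolding differential_l1_norm_def E
    by (subst infsum_reindex[OF inj_edge]) (auto simp: o_def case_prod_unfold)
  also have "\<dots> = (\<Sum>\<^sub>\<infinity>(z, i)\<in>UNIV. ?g (i, z))"
    by (simp only: w)
  also have "\<dots> = (\<Sum>\<^sub>\<infinity>(z, i)\<in>T \<times> UNIV. ?g (i, z))"
    by (rule infsum_cong_neutral) (auto intro: inT)
  also have "\<dots> = (\<Sum>z\<in>T. \<Sum>i\<in>UNIV. ?g (i, z))"
    using T by (simp add: sum.cartesian_product)
  also have "\<dots> = (\<Sum>i\<in>UNIV. \<Sum>z\<in>T. ?g (i, z))"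
    by (rule sum.swap)
  also have "\<dots> = (\<Sum>i\<in>UNIV. \<Sum>\<^sub>\<infinity>z. ?g (i, z))"
  proof (rule sum.cong[OF refl])
    fix i
    have "(\<Sum>\<^sub>\<infinity>z. ?g (i, z)) = (\<Sum>\<^sub>\<infinity>z\<in>T. ?g (i, z))"
      by (rule infsum_cong_neutral) (auto intro: inT)
    then show "(\<Sum>z\<in>T. ?g (i, z)) = (\<Sum>\<^sub>\<infinity>z. ?g (i, z))" using T by simp
  qed
  finally show ?thesis by simp
qed

end

theory Submission
  imports Defs
begin

text \<open>Write \<open>n = CARD('n)\<close>. Half the variation of \<open>f\<close> along a line in direction \<open>i\<close> bounds \<open>\<bar>f\<bar>\<close> on that
  line. Multiplying these \<open>n\<close> bounds and applying the functional Loomis--Whitney inequality gives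
  \<open>\<parallel>f\<parallel> \<le> (\<Prod>i. \<parallel>\<partial>\<^sub>i f\<parallel>\<^sub>1 / 2) powr (1 / n)\<close>, and the arithmetic--geometric mean inequality concludes.

  In the case of equality, the first bound shows that on each line \<open>f\<close> is constant on its support, an
  interval. Equality in Hoelder's inequality inside Loomis--Whitney shows that neighbouring parallel
  lines meet the support in the same set, so the lines through a point of the support span a box
  contained in it. Splitting \<open>f\<close> into this box and the rest, strict subadditivity of
  \<open>t powr (1 / p)\<close> shows that there is no rest, and equality in the mean inequality makes the box a
  cube.\<close>


section \<open>Mean and Hoelder inequalities with their equality cases\<close>

lemma prod_powr_le_mean:
  fixes x :: "'a \<Rightarrow> real"
  assumes I: "finite I" "I \<noteq> {}" and nn: "\<And>i. i \<in> I \<Longrightarrow> 0 \<le> x i"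
  shows "(\<Prod>i\<in>I. x i powr (1 / card I)) \<le> sum x I / card I"
    and "\<lbrakk>(\<Prod>i\<in>I. x i powr (1 / card I)) = sum x I / card I; \<And>i. i \<in> I \<Longrightarrow> 0 < x i; i \<in> I\<rbrakk>
      \<Longrightarrow> x i = sum x I / card I"
proof -
  define k \<mu> where "k = real (card I)" and "\<mu> = sum x I / card I"
  \<comment> \<open>\<open>d i\<close> is the gap in ln s \<le> s - 1 at s =
    \<open>x i / \<mu>\<close>. For positive \<open>x\<close> the geometric mean is
    \<open>\<mu> * exp (- sum d I / k)\<close>, so the inequality and its equality case both follow
    from \<open>d i\<close> being nonnegative.\<close>
  define d where "d i = x i / \<mu> - 1 - ln (x i / \<mu>)" for i
  have k: "0 < k" using I by (simp add: k_def card_gt_0_iff)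
  have *: "0 < \<mu> \<and> (\<Prod>i\<in>I. x i powr (1 / k)) = \<mu> * exp (- sum d I / k) \<and> (\<forall>i\<in>I. 0 \<le> d i)"
    if pos: "\<And>i. i \<in> I \<Longrightarrow> 0 < x i"
  proof (intro conjI ballI)
    show \<mu>: "0 < \<mu>" unfolding \<mu>_def using I pos k by (intro divide_pos_pos sum_pos) (auto simp: k_def)
    show "0 \<le> d i" if "i \<in> I" for i
      using ln_le_minus_one[of "x i / \<mu>"] pos[OF that] \<mu> by (simp add: d_def)
    have "(\<Sum>i\<in>I. ln (x i / \<mu>)) = (\<Sum>i\<in>I. ln (x i) - ln \<mu>)"
      using pos \<mu> by (intro sum.cong) (auto simp: ln_div less_imp_neq[THEN not_sym])
    then have "sum d I = sum x I / \<mu> - k - (\<Sum>i\<in>I. ln (x i)) + k * ln \<mu>"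
      by (simp add: d_def k_def sum_subtractf sum_divide_distrib[symmetric])
    also have "sum x I = k * \<mu>" using k by (simp add: \<mu>_def k_def)
    finally have "(\<Sum>i\<in>I. ln (x i)) = k * ln \<mu> - sum d I" using \<mu> by simp
    moreover have "(\<Prod>i\<in>I. x i powr (1 / k)) = exp ((\<Sum>i\<in>I. ln (x i)) / k)"
      using pos I by (simp add: powr_def sum_divide_distrib exp_sum less_imp_neq[THEN not_sym])
    ultimately have "(\<Prod>i\<in>I. x i powr (1 / k)) = exp (ln \<mu> + - sum d I / k)"
      using k by (simp add: diff_divide_distrib)
    then show "(\<Prod>i\<in>I. x i powr (1 / k)) = \<mu> * exp (- sum d I / k)"
      using \<mu> by (simp only: exp_add exp_ln)
  qed
  show "(\<Prod>i\<in>I. x i powr (1 / card I)) \<le> sum x I / card I"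
  proof (cases "\<forall>i\<in>I. 0 < x i")
    case True
    then have "0 < \<mu>" "(\<Prod>i\<in>I. x i powr (1 / k)) = \<mu> * exp (- sum d I / k)" "0 \<le> sum d I"
      using * by (auto intro: sum_nonneg)
    then have "(\<Prod>i\<in>I. x i powr (1 / k)) \<le> \<mu>" using k by (simp add: mult_le_cancel_left1)
    then show ?thesis by (simp add: k_def \<mu>_def)
  next
    case False
    then have "\<exists>i\<in>I. x i = 0" using nn by force
    then have "(\<Prod>i\<in>I. x i powr (1 / card I)) = 0" using I by (auto intro!: prod_zero)
    then show ?thesis using nn by (simp add: sum_nonneg)
  qed
  show "x i = sum x I / card I"
    if eq: "(\<Prod>i\<in>I. x i powr (1 / card I)) = sum x I / card I" and pos: "\<And>i. i \<in> I \<Longrightarrow> 0 < x i"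
      and i: "i \<in> I"
  proof -
    have "0 < \<mu>" "\<mu> * exp (- sum d I / k) = \<mu>" "\<forall>i\<in>I. 0 \<le> d i"
      using *[OF pos] eq by (auto simp: k_def \<mu>_def)
    then have "d i = 0" using I i k by (simp add: sum_nonneg_eq_0_iff)
    then have "x i / \<mu> = 1" using \<open>0 < \<mu>\<close> pos[OF i] by (intro ln_eq_minus_one) (auto simp: d_def)
    then have "x i = \<mu>" using \<open>0 < \<mu>\<close> by simp
    then show ?thesis by (simp add: \<mu>_def)
  qed
qed

text \<open>After normalizing each \<open>a i\<close> to total mass one, the inequality is the mean
  inequality summed over \<open>B\<close>. Equality then holds at every \<open>t\<close>; if one
  factor vanishes there, so does the product, hence the mean, hence every factor. The equality case
  thus says that the functions have the same zeros.\<close>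

lemma hoelder_prod_powr:
  fixes a :: "'i \<Rightarrow> 't \<Rightarrow> real"
  assumes B: "finite B" and I: "finite I" "I \<noteq> {}"
    and nn: "\<And>i t. i \<in> I \<Longrightarrow> t \<in> B \<Longrightarrow> 0 \<le> a i t"
  shows "(\<Sum>t\<in>B. \<Prod>i\<in>I. a i t powr (1 / card I)) \<le> (\<Prod>i\<in>I. sum (a i) B powr (1 / card I))"
    and "\<lbrakk>(\<Sum>t\<in>B. \<Prod>i\<in>I. a i t powr (1 / card I)) = (\<Prod>i\<in>I. sum (a i) B powr (1 / card I));
      \<And>i. i \<in> I \<Longrightarrow> 0 < sum (a i) B; t \<in> B; i \<in> I; a i t = 0; j \<in> I\<rbrakk> \<Longrightarrow> a j t = 0"
proof -
  define k where "k = real (card I)"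
  have k: "0 < k" using I by (simp add: k_def card_gt_0_iff)
  define P where "P = (\<Prod>i\<in>I. sum (a i) B powr (1 / k))"
  define b where "b i t = a i t / sum (a i) B" for i t
  have bnn: "0 \<le> b i t" if "i \<in> I" "t \<in> B" for i t
    using nn that by (auto simp: b_def intro!: divide_nonneg_nonneg sum_nonneg)
  have amgm: "(\<Prod>i\<in>I. b i t powr (1 / k)) \<le> (\<Sum>i\<in>I. b i t) / k" if "t \<in> B" for t
    unfolding k_def using I bnn that by (intro prod_powr_le_mean(1)) auto
  have mean: "(\<Sum>t\<in>B. (\<Sum>i\<in>I. b i t) / k) = 1" if pos: "\<And>i. i \<in> I \<Longrightarrow> 0 < sum (a i) B"
  proof -
    have "(\<Sum>t\<in>B. (\<Sum>i\<in>I. b i t)) = (\<Sum>i\<in>I. sum (a i) B / sum (a i) B)"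
      unfolding b_def sum_divide_distrib by (rule sum.swap)
    also have "\<dots> = k" using pos by (simp add: k_def less_imp_neq[THEN not_sym])
    finally show ?thesis using k by (simp add: sum_divide_distrib[symmetric])
  qed
  have norm: "(\<Sum>t\<in>B. \<Prod>i\<in>I. a i t powr (1 / k)) = P * (\<Sum>t\<in>B. \<Prod>i\<in>I. b i t powr (1 / k))"
    if pos: "\<And>i. i \<in> I \<Longrightarrow> 0 < sum (a i) B"
  proof -
    have "a i t powr (1 / k) = sum (a i) B powr (1 / k) * b i t powr (1 / k)" if "i \<in> I" "t \<in> B" for i t
      using pos[OF that(1)] nn[OF that] by (simp add: b_def powr_divide)
    then show ?thesis by (simp add: P_def prod.distrib sum_distrib_left cong: prod.cong)
  qed
  show "(\<Sum>t\<in>B. \<Prod>i\<in>I. a i t powr (1 / card I)) \<le> (\<Prod>i\<in>I. sum (a i) B powr (1 / card I))"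
  proof (cases "\<forall>i\<in>I. 0 < sum (a i) B")
    case True
    have "P \<ge> 0" by (simp add: P_def prod_nonneg)
    moreover have "(\<Sum>t\<in>B. \<Prod>i\<in>I. b i t powr (1 / k)) \<le> (\<Sum>t\<in>B. (\<Sum>i\<in>I. b i t) / k)"
      by (intro sum_mono amgm)
    ultimately show ?thesis
      using norm mean True unfolding P_def[symmetric] k_def[symmetric] by (simp add: mult_left_le)
  next
    case False
    then obtain i where i: "i \<in> I" "sum (a i) B = 0"
      using nn by (meson not_less order.antisym sum_nonneg)
    then have "\<forall>t\<in>B. a i t = 0" using B nn by (simp add: sum_nonneg_eq_0_iff)
    then have "(\<Prod>i\<in>I. a i t powr (1 / card I)) = 0" if "t \<in> B" for t
      using I i that by (auto intro!: prod_zero)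
    then show ?thesis by (simp add: prod_nonneg)
  qed
  show "a j t = 0"
    if eq: "(\<Sum>t\<in>B. \<Prod>i\<in>I. a i t powr (1 / card I)) = (\<Prod>i\<in>I. sum (a i) B powr (1 / card I))"
      and pos: "\<And>i. i \<in> I \<Longrightarrow> 0 < sum (a i) B" and t: "t \<in> B" and i: "i \<in> I" "a i t = 0" and j: "j \<in> I"
  proof -
    have "P > 0" unfolding P_def using pos by (intro prod_pos) (simp add: less_imp_neq[THEN not_sym])
    moreover have "P * (\<Sum>t\<in>B. \<Prod>i\<in>I. b i t powr (1 / k)) = P"
      using norm[OF pos] eq by (simp add: k_def P_def)
    ultimately have "(\<Sum>t\<in>B. \<Prod>i\<in>I. b i t powr (1 / k)) = (\<Sum>t\<in>B. (\<Sum>i\<in>I. b i t) / k)"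
      using mean[OF pos] by simp
    then have "(\<Sum>t\<in>B. (\<Sum>i\<in>I. b i t) / k - (\<Prod>i\<in>I. b i t powr (1 / k))) = 0"
      by (simp add: sum_subtractf)
    then have "(\<Sum>i\<in>I. b i t) / k = (\<Prod>i\<in>I. b i t powr (1 / k))"
      using amgm B t by (subst (asm) sum_nonneg_eq_0_iff) auto
    also have "\<dots> = 0" using I i by (auto intro!: prod_zero simp: b_def)
    finally have "(\<Sum>i\<in>I. b i t) = 0" using k by simp
    then have "b j t = 0" using I j bnn t by (subst (asm) sum_nonneg_eq_0_iff) auto
    then show ?thesis using pos[OF j] by (simp add: b_def)
  qed
qed

section \<open>Sums over cylinders and the functional Loomis--Whitney inequality\<close>

text \<open>Coordinates outside \<open>J\<close> are frozen at those of \<open>x\<close> instead of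
  being dropped, so partial sums run over points of one fixed type and \<open>J\<close> can grow by
  induction.\<close>

definition cyl :: "'b set \<Rightarrow> 'a set \<Rightarrow> ('a \<Rightarrow> 'b) \<Rightarrow> ('a \<Rightarrow> 'b) set" where
  "cyl B J x = {y. (\<forall>i\<in>J. y i \<in> B) \<and> (\<forall>i. i \<notin> J \<longrightarrow> y i = x i)}"

lemma cyl_empty [simp]: "cyl B {} x = {x}"
  by (auto simp: cyl_def)

lemma cyl_singleton: "cyl B {j} x = (\<lambda>t. x(j := t)) ` B"
  by (auto simp: cyl_def image_iff fun_eq_iff)

lemma finite_cyl [simp]:
  fixes x :: "'a::finite \<Rightarrow> 'b"
  assumes "finite B"
  shows "finite (cyl B J x)"
proof (rule finite_subset)
  show "cyl B J x \<subseteq> PiE UNIV (\<lambda>i. B \<union> range x)" by (auto simp: cyl_def)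
  show "finite (PiE (UNIV :: 'a set) (\<lambda>i. B \<union> range x))" by (rule finite_PiE) (simp_all add: assms)
qed

lemma sum_cyl_singleton: "(\<Sum>y\<in>cyl B {j} x. h y) = (\<Sum>t\<in>B. h (x(j := t)))"
  by (simp add: cyl_singleton, subst sum.reindex) (auto simp: inj_on_def fun_eq_iff split: if_splits)

lemma sum_cyl_Un:
  fixes x :: "'a::finite \<Rightarrow> 'b"
  assumes "finite B" "J \<inter> K = {}"
  shows "sum h (cyl B (J \<union> K) x) = (\<Sum>y\<in>cyl B J x. sum h (cyl B K y))"
proof -
  have "cyl B (J \<union> K) x = (\<Union>y\<in>cyl B J x. cyl B K y)"
  proof (intro set_eqI iffI)
    fix z assume "z \<in> cyl B (J \<union> K) x"
    \<comment> \<open>The intermediate point takes its \<open>J\<close>-coordinates from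
      \<open>z\<close> and all others from \<open>x\<close>.\<close>
    then have "override_on x z J \<in> cyl B J x" "z \<in> cyl B K (override_on x z J)"
      by (auto simp: cyl_def override_on_def)
    then show "z \<in> (\<Union>y\<in>cyl B J x. cyl B K y)" by blast
  qed (use assms in \<open>auto simp: cyl_def\<close>)
  moreover have "cyl B K y \<inter> cyl B K y' = {}" if "y \<in> cyl B J x" "y' \<in> cyl B J x" "y \<noteq> y'" for y y'
  proof -
    obtain i where "y i \<noteq> y' i" using \<open>y \<noteq> y'\<close> by blast
    moreover have "i \<notin> K" if "i \<in> J" using that assms(2) by blast
    moreover have "i \<in> J" using \<open>y i \<noteq> y' i\<close> that by (auto simp: cyl_def)
    ultimately show ?thesis by (auto simp: cyl_def)
  qed
  ultimately show ?thesis using assms by (simp add: sum.UNION_disjoint)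
qed

lemma sum_cyl_insert:
  fixes x :: "'a::finite \<Rightarrow> 'b"
  assumes "finite B" "j \<notin> J"
  shows "sum h (cyl B (insert j J) x) = (\<Sum>t\<in>B. sum h (cyl B J (x(j := t))))"
  using sum_cyl_Un[of B "{j}" J h x] assms by (simp add: sum_cyl_singleton)

lemma sum_cyl_upd_indep:
  fixes x :: "'a::finite \<Rightarrow> 'b"
  assumes indep: "\<And>x t. h (x(j := t)) = h x" and "j \<notin> J"
  shows "sum h (cyl B J (x(j := t))) = sum h (cyl B J x)"
proof (rule sum.reindex_bij_witness[of _ "\<lambda>y. y(j := t)" "\<lambda>y. y(j := x j)"])
qed (use assms in \<open>auto simp: cyl_def fun_eq_iff\<close>)

text \<open>Every step sums over one more coordinate \<open>j\<close>: the factor \<open>g j\<close> does not see it, and the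
  remaining \<open>CARD('a) - 1\<close> factors are estimated by Hoelder's inequality with equal exponents.\<close>

lemma loomis_whitney_cyl:
  fixes g :: "'a::finite \<Rightarrow> ('a \<Rightarrow> 'b) \<Rightarrow> real"
  assumes B: "finite B" and n: "2 \<le> CARD('a)"
    and nn: "\<And>i x. 0 \<le> g i x" and indep: "\<And>i x t. g i (x(i := t)) = g i x"
  defines "q \<equiv> 1 / (real CARD('a) - 1)"
  shows "(\<Sum>y\<in>cyl B J x. \<Prod>i\<in>UNIV. g i y powr q) \<le> (\<Prod>i\<in>UNIV. sum (g i) (cyl B (J - {i}) x) powr q)"
proof (induction J arbitrary: x rule: finite_induct[OF finite])
  case 1
  then show ?case by simp
next
  case (2 j J)
  define I where "I = UNIV - {j}"
  have "card I = CARD('a) - 1" by (simp add: I_def card_Diff_singleton)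
  then have "card I \<noteq> 0" "1 / card I = q" using n by (auto simp: q_def of_nat_diff)
  moreover from this(1) have "I \<noteq> {}" by (metis card.empty)
  ultimately have I: "finite I" "I \<noteq> {}" "1 / card I = q" "j \<notin> I" by (simp_all add: I_def)
  have U: "prod h UNIV = h j * prod h I" for h :: "'a \<Rightarrow> real"
    unfolding I_def by (subst prod.remove[of _ j]) auto
  define s where "s i t = sum (g i) (cyl B (J - {i}) (x(j := t)))" for i t
  have s0: "0 \<le> s i t" for i t by (simp add: s_def sum_nonneg nn)
  have "(\<Sum>y\<in>cyl B (insert j J) x. \<Prod>i\<in>UNIV. g i y powr q)
      = (\<Sum>t\<in>B. \<Sum>y\<in>cyl B J (x(j := t)). \<Prod>i\<in>UNIV. g i y powr q)"
    using B 2(2) by (rule sum_cyl_insert)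
  also have "\<dots> \<le> (\<Sum>t\<in>B. \<Prod>i\<in>UNIV. s i t powr q)"
    unfolding s_def by (intro sum_mono 2)
  also have "\<dots> = (\<Sum>t\<in>B. sum (g j) (cyl B J x) powr q * (\<Prod>i\<in>I. s i t powr q))"
    using 2(2) sum_cyl_upd_indep[of "g j" j J, OF indep] by (simp add: U s_def)
  also have "\<dots> = sum (g j) (cyl B J x) powr q * (\<Sum>t\<in>B. \<Prod>i\<in>I. s i t powr q)"
    by (simp add: sum_distrib_left)
  also have "\<dots> \<le> sum (g j) (cyl B J x) powr q * (\<Prod>i\<in>I. sum (s i) B powr q)"
    using hoelder_prod_powr(1)[OF B I(1,2), of s] s0 by (intro mult_left_mono) (auto simp: I(3))
  also have "(\<Prod>i\<in>I. sum (s i) B powr q) = (\<Prod>i\<in>I. sum (g i) (cyl B (insert j J - {i}) x) powr q)"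
  proof (rule prod.cong[OF refl])
    fix i assume "i \<in> I"
    then have "insert j J - {i} = insert j (J - {i})" by (auto simp: I_def)
    then show "sum (s i) B powr q = sum (g i) (cyl B (insert j J - {i}) x) powr q"
      using B 2(2) by (simp add: s_def sum_cyl_insert)
  qed
  also have "sum (g j) (cyl B J x) powr q * \<dots> = (\<Prod>i\<in>UNIV. sum (g i) (cyl B (insert j J - {i}) x) powr q)"
    using 2(2) by (simp add: U)
  finally show ?case .
qed

text \<open>Starting the summation with the coordinate \<open>j\<close> forces equality in the first application
  of Hoelder's inequality, on every line in direction \<open>j\<close>.\<close>

lemma loomis_whitney_eq:
  fixes g :: "'a::finite \<Rightarrow> ('a \<Rightarrow> 'b) \<Rightarrow> real"
  assumes B: "finite B" and n: "2 \<le> CARD('a)"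
    and nn: "\<And>i x. 0 \<le> g i x" and indep: "\<And>i x t. g i (x(i := t)) = g i x"
  defines "q \<equiv> 1 / (real CARD('a) - 1)"
  assumes eq: "(\<Sum>y\<in>cyl B UNIV x. \<Prod>i\<in>UNIV. g i y powr q)
      = (\<Prod>i\<in>UNIV. sum (g i) (cyl B (UNIV - {i}) x) powr q)"
    and y: "\<And>i. y i \<in> B" "\<And>i. 0 < g i y" and t: "t \<in> B" and k: "k \<noteq> j" "0 < g k (y(j := t))"
  shows "0 < g i (y(j := t))"
proof (cases "i = j")
  case True
  then show ?thesis using y(2)[of j] indep by simp
next
  case False
  define I where "I = UNIV - {j}"
  have "card I = CARD('a) - 1" by (simp add: I_def card_Diff_singleton)
  then have "card I \<noteq> 0" "1 / card I = q" using n by (auto simp: q_def of_nat_diff)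
  moreover from this(1) have "I \<noteq> {}" by (metis card.empty)
  ultimately have I: "finite I" "I \<noteq> {}" "1 / card I = q" "j \<notin> I" by (simp_all add: I_def)
  have U: "prod h UNIV = h j * prod h I" for h :: "'a \<Rightarrow> real"
    unfolding I_def by (subst prod.remove[of _ j]) auto
  \<comment> \<open>\<open>h i\<close> is \<open>g i\<close> already summed along direction
    \<open>j\<close>, except that \<open>g j\<close> is constant on those lines. Hoelder on each
    line bounds the line sum \<open>L\<close> by the product of the \<open>h i\<close>;
    Loomis--Whitney for \<open>h\<close> in the remaining coordinates then ends at the right-hand
    side of \<open>eq\<close>, so both inequalities must be equalities.\<close>
  define h where "h i y = (if i = j then g j y else \<Sum>t\<in>B. g i (y(j := t)))" for i y
  define L where "L y = (\<Sum>t\<in>B. \<Prod>i\<in>UNIV. g i (y(j := t)) powr q)" for y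
  have L_eq: "L y = g j y powr q * (\<Sum>t\<in>B. \<Prod>i\<in>I. g i (y(j := t)) powr q)" for y
    by (simp add: L_def U indep sum_distrib_left)
  have R_eq: "(\<Prod>i\<in>UNIV. h i y powr q) = g j y powr q * (\<Prod>i\<in>I. (\<Sum>t\<in>B. g i (y(j := t))) powr q)" for y
    using I(4) by (auto simp: U h_def intro!: prod.cong)
  have LR: "L y \<le> (\<Prod>i\<in>UNIV. h i y powr q)" for y
    unfolding L_eq R_eq
    using hoelder_prod_powr(1)[OF B I(1,2), of "\<lambda>i t. g i (y(j := t))"] nn
    by (intro mult_left_mono) (auto simp: I(3))
  have "I \<union> {j} = UNIV" by (auto simp: I_def)
  then have "(\<Sum>y\<in>cyl B I x. L y) = (\<Sum>y\<in>cyl B UNIV x. \<Prod>i\<in>UNIV. g i y powr q)"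
    using sum_cyl_Un[OF B, of I "{j}" "\<lambda>y. \<Prod>i\<in>UNIV. g i y powr q" x] I(4)
    by (simp add: L_def sum_cyl_singleton)
  also note eq
  also have "(\<Prod>i\<in>UNIV. sum (g i) (cyl B (UNIV - {i}) x) powr q) = (\<Prod>i\<in>UNIV. sum (h i) (cyl B (I - {i}) x) powr q)"
  proof (rule prod.cong[OF refl])
    fix i
    show "sum (g i) (cyl B (UNIV - {i}) x) powr q = sum (h i) (cyl B (I - {i}) x) powr q"
    proof (cases "i = j")
      case True
      then show ?thesis using I(4) by (simp add: h_def[abs_def]) (simp add: I_def)
    next
      case False
      then have *: "UNIV - {i} = (I - {i}) \<union> {j}" by (auto simp: I_def)
      show ?thesis
        using False B I(4) unfolding * by (subst sum_cyl_Un) (auto simp: sum_cyl_singleton h_def[abs_def])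
    qed
  qed
  also have "\<dots> \<ge> (\<Sum>y\<in>cyl B I x. \<Prod>i\<in>UNIV. h i y powr q)"
    unfolding q_def
  proof (intro loomis_whitney_cyl B n)
    show "h i (x(i := t)) = h i x" for i x t
      using indep[of i "x(j := _)" t] indep[of j] by (auto simp: h_def fun_upd_twist[of i j])
  qed (simp add: h_def nn sum_nonneg)
  finally have le: "(\<Sum>y\<in>cyl B I x. \<Prod>i\<in>UNIV. h i y powr q) \<le> (\<Sum>y\<in>cyl B I x. L y)" .
  have "(\<Sum>y\<in>cyl B I x. (\<Prod>i\<in>UNIV. h i y powr q) - L y) = 0"
    using le LR by (intro antisym) (auto simp: sum_subtractf intro!: sum_mono)
  then have all: "L z = (\<Prod>i\<in>UNIV. h i z powr q)" if "z \<in> cyl B I x" for z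
    using B LR that by (subst (asm) sum_nonneg_eq_0_iff) auto
  \<comment> \<open>The cylinder over \<open>I\<close> has its \<open>j\<close>-th coordinate frozen
    at \<open>x j\<close>. Both sides of the line equality ignore that coordinate, so it passes on
    to \<open>y\<close>.\<close>
  have "y(j := x j) \<in> cyl B I x" using y by (auto simp: cyl_def I_def)
  from all[OF this] have "g j y powr q * (\<Sum>t\<in>B. \<Prod>i\<in>I. g i (y(j := t)) powr q)
     = g j y powr q * (\<Prod>i\<in>I. (\<Sum>t\<in>B. g i (y(j := t))) powr q)"
    unfolding L_eq R_eq by (simp add: indep)
  then have *: "(\<Sum>t\<in>B. \<Prod>i\<in>I. g i (y(j := t)) powr (1 / card I))
     = (\<Prod>i\<in>I. (\<Sum>t\<in>B. g i (y(j := t))) powr (1 / card I))"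
    using y(2)[of j] by (simp add: I(3))
  have pos: "0 < (\<Sum>t\<in>B. g i (y(j := t)))" for i
    using B nn y[of j] y(2)[of i] by (intro sum_pos2[of _ "y j"]) auto
  have "g i (y(j := t)) \<noteq> 0"
    using hoelder_prod_powr(2)[OF B I(1,2) _ * pos t, where i = i and j = k] nn k False
    by (auto simp: I_def)
  then show ?thesis using nn[of i "y(j := t)"] by simp
qed


section \<open>Variation along a line\<close>

lemma abs_diff_le_sum_steps:
  fixes u :: "int \<Rightarrow> real"
  assumes "a \<le> b"
  shows "\<bar>u b - u a\<bar> \<le> (\<Sum>t\<in>{a..<b}. \<bar>u (t + 1) - u t\<bar>)"
  using assms
proof (induction b rule: int_ge_induct)
  case (step b)
  then have "{a..<b + 1} = insert b {a..<b}" by auto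
  then show ?case using step by simp
qed simp

text \<open>The range from \<open>-N\<close> to \<open>N + 1\<close> is cut at \<open>a\<close>,
  \<open>c\<close>, \<open>b\<close>, and each piece obeys the triangle inequality; \<open>u\<close>
  vanishes at both ends. With \<open>a = c = b\<close> this gives twice the absolute value, and a
  genuine \<open>c\<close> gives rigidity between two extreme points.\<close>

lemma three_point_variation_le:
  fixes u :: "int \<Rightarrow> real"
  assumes supp: "\<And>t. u t \<noteq> 0 \<Longrightarrow> -N < t \<and> t < N"
    and "-N \<le> a" "a \<le> c" "c \<le> b" "b \<le> N"
  shows "\<bar>u a\<bar> + \<bar>u c - u a\<bar> + \<bar>u b - u c\<bar> + \<bar>u b\<bar> \<le> (\<Sum>t\<in>{-N..N}. \<bar>u (t + 1) - u t\<bar>)"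
proof -
  let ?V = "\<lambda>a b. \<Sum>t\<in>{a..<b}. \<bar>u (t + 1) - u t\<bar>"
  have join: "?V a c = ?V a b + ?V b c" if "a \<le> b" "b \<le> c" for a b c
    using that by (subst sum.union_disjoint[symmetric]) (auto intro!: sum.cong)
  have "{-N..N} = {-N..<N + 1}" by auto
  moreover have "u (-N) = 0" "u (N + 1) = 0" using supp by force+
  ultimately show ?thesis
    using abs_diff_le_sum_steps[of "-N" a u] abs_diff_le_sum_steps[of a c u]
      abs_diff_le_sum_steps[of c b u] abs_diff_le_sum_steps[of b "N + 1" u] assms
      join[of "-N" a "N + 1"] join[of a c "N + 1"] join[of c b "N + 1"] by simp
qed

section \<open>Norms over a finite window and the Sobolev inequality\<close>

definition window :: "int \<Rightarrow> ('n \<Rightarrow> int) set" where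
  "window N = {x. \<forall>i. x i \<in> {-N..N}}"

definition line_variation :: "int \<Rightarrow> (('n \<Rightarrow> int) \<Rightarrow> real) \<Rightarrow> 'n \<Rightarrow> ('n \<Rightarrow> int) \<Rightarrow> real" where
  "line_variation N F i x = (\<Sum>t\<in>{-N..N}. \<bar>F (x(i := t + 1)) - F (x(i := t))\<bar>)"

definition grad_norm :: "int \<Rightarrow> (('n \<Rightarrow> int) \<Rightarrow> real) \<Rightarrow> 'n \<Rightarrow> real" where
  "grad_norm N F i = (\<Sum>x\<in>window N. \<bar>F (x(i := x i + 1)) - F x\<bar>)"

definition sobolev_norm :: "int \<Rightarrow> (('n::finite \<Rightarrow> int) \<Rightarrow> real) \<Rightarrow> real" where
  "sobolev_norm N F = (\<Sum>x\<in>window N. \<bar>F x\<bar> powr (real CARD('n) / (real CARD('n) - 1)))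
     powr (1 / (real CARD('n) / (real CARD('n) - 1)))"

lemma window_eq_cyl: "window N = cyl {-N..N} UNIV x"
  by (simp add: window_def cyl_def)

lemma finite_window [simp]: "finite (window N :: ('n::finite \<Rightarrow> int) set)"
  by (simp add: window_eq_cyl[of N undefined])

text \<open>The window is fibred into lines in direction \<open>i\<close>; freezing the
  \<open>i\<close>-th coordinate at \<open>x i\<close> selects each line once.\<close>

lemma grad_norm_eq_sum_line_variation:
  fixes F :: "('n::finite \<Rightarrow> int) \<Rightarrow> real"
  shows "grad_norm N F i = sum (line_variation N F i) (cyl {-N..N} (UNIV - {i}) x)"
proof -
  have "UNIV = (UNIV - {i}) \<union> {i}" by auto
  then have "window N = cyl {-N..N} ((UNIV - {i}) \<union> {i}) x" by (simp add: window_eq_cyl[of _ x])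
  then show ?thesis
    by (simp only: grad_norm_def, subst sum_cyl_Un) (auto simp: sum_cyl_singleton line_variation_def[abs_def])
qed

text \<open>Points are functions, so that moving along a line is a function update. The bounds on
  the support are strict so that every step into or out of it starts in the window.\<close>

locale lattice_function =
  fixes F :: "('n::finite \<Rightarrow> int) \<Rightarrow> real" and N :: int
  assumes two_le_card: "2 \<le> CARD('n)"
    and supp: "F x \<noteq> 0 \<Longrightarrow> -N < x i \<and> x i < N"
begin

definition g :: "'n \<Rightarrow> ('n \<Rightarrow> int) \<Rightarrow> real" where
  "g i x = line_variation N F i x / 2"

definition p :: real where "p = real CARD('n) / (real CARD('n) - 1)"

definition q :: real where "q = 1 / (real CARD('n) - 1)"

lemma q_pos: "0 < q" and p_pos: "0 < p" and p_gt_1: "1 < p"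
  and p_eq: "p = q * real CARD('n)"
  using two_le_card by (auto simp: p_def q_def)

lemma g_nonneg: "0 \<le> g i x"
  by (simp add: g_def line_variation_def sum_nonneg)

lemma g_indep: "g i (x(i := t)) = g i x"
  by (simp add: g_def line_variation_def)

lemma sum_g: "sum (g i) (cyl {-N..N} (UNIV - {i}) x) = grad_norm N F i / 2"
  by (simp add: grad_norm_eq_sum_line_variation[of _ _ _ x] g_def[abs_def] sum_divide_distrib)

lemma three_point_le_g:
  assumes "-N \<le> a" "a \<le> c" "c \<le> b" "b \<le> N"
  shows "\<bar>F (x(i := a))\<bar> + \<bar>F (x(i := c)) - F (x(i := a))\<bar> + \<bar>F (x(i := b)) - F (x(i := c))\<bar>
    + \<bar>F (x(i := b))\<bar> \<le> 2 * g i x"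
proof -
  have "-N < t \<and> t < N" if "F (x(i := t)) \<noteq> 0" for t
    using supp[OF that, of i] by simp
  from three_point_variation_le[of "\<lambda>t. F (x(i := t))", OF this assms]
  show ?thesis by (simp add: g_def line_variation_def)
qed

lemma abs_le_g: "\<bar>F x\<bar> \<le> g i x"
proof (cases "F x = 0")
  case False
  then show ?thesis using supp[OF False, of i] three_point_le_g[of "x i" "x i" "x i" x i] by simp
qed (simp add: g_nonneg)

lemma g_pos: "F x \<noteq> 0 \<Longrightarrow> 0 < g i x"
  using abs_le_g[of x i] by linarith

text \<open>As \<open>p\<close> is \<open>CARD('n)\<close> times \<open>q\<close>, the power splits
  into one factor per direction, each to be bounded by its own \<open>g i x\<close>.\<close>

lemma abs_powr_p: "\<bar>F x\<bar> powr p = (\<Prod>i\<in>(UNIV :: 'n set). \<bar>F x\<bar> powr q)"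
  by (simp add: p_eq powr_powr[symmetric] powr_realpow')

lemma abs_powr_p_le: "\<bar>F x\<bar> powr p \<le> (\<Prod>i\<in>UNIV. g i x powr q)"
  unfolding abs_powr_p using abs_le_g q_pos by (intro prod_mono) (auto intro: powr_mono2)

lemma sum_powr_le_sum_prod:
  "(\<Sum>x\<in>window N. \<bar>F x\<bar> powr p) \<le> (\<Sum>x\<in>window N. \<Prod>i\<in>UNIV. g i x powr q)"
  by (intro sum_mono abs_powr_p_le)

lemma sum_prod_g_le:
  "(\<Sum>x\<in>window N. \<Prod>i\<in>UNIV. g i x powr q) \<le> (\<Prod>i\<in>UNIV. (grad_norm N F i / 2) powr q)"
  using loomis_whitney_cyl[of "{-N..N}" g UNIV undefined] two_le_card g_nonneg g_indep
  by (simp add: window_eq_cyl[of _ undefined] sum_g q_def)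

lemma grad_norm_nonneg: "0 \<le> grad_norm N F i"
  by (simp add: grad_norm_def sum_nonneg)

lemma prod_grad_norm_powr:
  "(\<Prod>i\<in>UNIV. (grad_norm N F i / 2) powr q) powr (1 / p)
    = (\<Prod>i\<in>UNIV. (grad_norm N F i / 2) powr (1 / real CARD('n)))"
proof -
  have "q * (1 / p) = 1 / real CARD('n)" using q_pos by (simp add: p_eq)
  then show ?thesis by (simp add: prod_powr_distrib powr_powr)
qed

lemma sum_powr_le:
  "(\<Sum>x\<in>window N. \<bar>F x\<bar> powr p) \<le> (\<Prod>i\<in>UNIV. (grad_norm N F i / 2) powr q)"
  using sum_powr_le_sum_prod sum_prod_g_le by (rule order.trans)

lemma sobolev_norm_eq: "sobolev_norm N F = (\<Sum>x\<in>window N. \<bar>F x\<bar> powr p) powr (1 / p)"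
  by (simp add: sobolev_norm_def p_def)

lemma sobolev_norm_le_prod:
  "sobolev_norm N F \<le> (\<Prod>i\<in>UNIV. (grad_norm N F i / 2) powr (1 / real CARD('n)))"
  unfolding sobolev_norm_eq prod_grad_norm_powr[symmetric]
  using sum_powr_le p_pos by (intro powr_mono2) (auto simp: sum_nonneg)

lemma prod_grad_norm_le:
  "(\<Prod>i\<in>UNIV. (grad_norm N F i / 2) powr (1 / real CARD('n)))
    \<le> (\<Sum>i\<in>UNIV. grad_norm N F i / 2) / real CARD('n)"
  using grad_norm_nonneg by (intro prod_powr_le_mean(1)) auto

lemma sobolev: "sobolev_norm N F \<le> (\<Sum>i\<in>UNIV. grad_norm N F i / 2) / real CARD('n)"
  using sobolev_norm_le_prod prod_grad_norm_le by (rule order.trans)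

lemma sobolev_norm_powr_p: "sobolev_norm N F powr p = (\<Sum>x\<in>window N. \<bar>F x\<bar> powr p)"
  using p_pos by (simp add: sobolev_norm_eq powr_powr sum_nonneg)

lemma in_window: "F x \<noteq> 0 \<Longrightarrow> x \<in> window N"
  using supp by (fastforce simp: window_def intro: less_imp_le)

lemma sobolev_norm_pos: "F x \<noteq> 0 \<Longrightarrow> 0 < sobolev_norm N F"
proof -
  assume x: "F x \<noteq> 0"
  have "0 < (\<Sum>x\<in>window N. \<bar>F x\<bar> powr p)"
    using x in_window[OF x] by (intro sum_pos2[of _ x]) auto
  then show ?thesis by (simp add: sobolev_norm_eq less_imp_neq[THEN not_sym])
qed

end

section \<open>Rigidity in the case of equality\<close>

locale extremal_function = lattice_function +
  fixes x0 :: "'a \<Rightarrow> int"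
  assumes x0: "F x0 \<noteq> 0"
    and extremal: "sobolev_norm N F = (\<Sum>i\<in>UNIV. grad_norm N F i / 2) / real CARD('a)"
begin

text \<open>The geometric mean lies between two quantities that \<open>extremal\<close>
  identifies.\<close>

lemma prod_grad_norm_eq:
  "(\<Prod>i\<in>UNIV. (grad_norm N F i / 2) powr (1 / real CARD('a)))
    = (\<Sum>i\<in>UNIV. grad_norm N F i / 2) / real CARD('a)"
  and sobolev_norm_eq_prod:
  "sobolev_norm N F = (\<Prod>i\<in>UNIV. (grad_norm N F i / 2) powr (1 / real CARD('a)))"
  using sobolev_norm_le_prod prod_grad_norm_le extremal by linarith+

lemma grad_norm_pos: "0 < grad_norm N F i"
proof (rule ccontr)
  assume "\<not> 0 < grad_norm N F i"
  then have "grad_norm N F i = 0" using grad_norm_nonneg[of i] by linarith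
  then have "(\<Prod>i\<in>UNIV. (grad_norm N F i / 2) powr (1 / real CARD('a))) = 0"
    by (auto intro!: prod_zero)
  then show False using sobolev_norm_pos[OF x0] sobolev_norm_eq_prod by linarith
qed

lemma grad_norm_const: "grad_norm N F i = grad_norm N F j"
proof -
  have "grad_norm N F i / 2 = (\<Sum>i\<in>UNIV. grad_norm N F i / 2) / real CARD('a)" for i
    using prod_grad_norm_eq grad_norm_pos by (intro prod_powr_le_mean(2)) (auto intro: less_imp_le)
  from this[of i] this[of j] show ?thesis by simp
qed

lemma sum_powr_eq:
  "(\<Sum>x\<in>window N. \<bar>F x\<bar> powr p) = (\<Prod>i\<in>UNIV. (grad_norm N F i / 2) powr q)"
proof -
  have "(\<Sum>x\<in>window N. \<bar>F x\<bar> powr p)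
      = ((\<Prod>i\<in>UNIV. (grad_norm N F i / 2) powr q) powr (1 / p)) powr p"
    by (simp only: sobolev_norm_powr_p[symmetric] sobolev_norm_eq_prod prod_grad_norm_powr)
  then show ?thesis using p_pos by (simp add: powr_powr prod_nonneg)
qed

lemma sum_prod_g_eq:
  "(\<Sum>x\<in>window N. \<Prod>i\<in>UNIV. g i x powr q) = (\<Prod>i\<in>UNIV. (grad_norm N F i / 2) powr q)"
  and sum_powr_eq': "(\<Sum>x\<in>window N. \<bar>F x\<bar> powr p) = (\<Sum>x\<in>window N. \<Prod>i\<in>UNIV. g i x powr q)"
  using sum_powr_eq sum_prod_g_le sum_powr_le_sum_prod by linarith+

text \<open>Equality of the sums forces equality of the products at each point of the window. With
  all factors positive, a single strict inequality \<open>\<bar>F x\<bar> < g i x\<close> would make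
  the products differ.\<close>

lemma abs_eq_g:
  assumes "x \<in> window N" "\<And>i. 0 < g i x"
  shows "\<bar>F x\<bar> = g i x"
proof -
  have "(\<Sum>x\<in>window N. (\<Prod>i\<in>UNIV. g i x powr q) - \<bar>F x\<bar> powr p) = 0"
    using sum_powr_eq' by (simp add: sum_subtractf)
  then have *: "(\<Prod>i\<in>UNIV. g i x powr q) = (\<Prod>i\<in>(UNIV::'a set). \<bar>F x\<bar> powr q)"
    using abs_powr_p_le assms by (subst (asm) sum_nonneg_eq_0_iff) (auto simp: abs_powr_p)
  show ?thesis
  proof (rule ccontr)
    assume "\<bar>F x\<bar> \<noteq> g i x"
    then have "\<bar>F x\<bar> < g i x" using abs_le_g[of x i] by simp
    then have "\<bar>F x\<bar> powr q < g i x powr q" using q_pos by (intro powr_less_mono2) auto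
    moreover have "0 < (\<Prod>i\<in>UNIV - {i}. g i x powr q)"
      using assms(2) by (intro prod_pos) (simp add: less_imp_neq[THEN not_sym])
    moreover have "(\<Prod>i\<in>UNIV - {i}. \<bar>F x\<bar> powr q) \<le> (\<Prod>i\<in>UNIV - {i}. g i x powr q)"
      using abs_le_g q_pos by (intro prod_mono) (auto intro: powr_mono2)
    ultimately have "\<bar>F x\<bar> powr q * (\<Prod>i\<in>UNIV - {i}. \<bar>F x\<bar> powr q)
        < g i x powr q * (\<Prod>i\<in>UNIV - {i}. g i x powr q)"
      by (meson le_less_trans mult_left_mono mult_strict_right_mono powr_ge_zero)
    then show False
      using * prod.remove[of UNIV i "\<lambda>i. g i x powr q"] prod.remove[of UNIV i "\<lambda>_. \<bar>F x\<bar> powr q"]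
      by (simp del: prod_constant)
  qed
qed

text \<open>The points \<open>x(j := t)\<close> and \<open>x(k := s, j := t)\<close> share a line in
  direction \<open>k\<close>, so \<open>g k\<close> is positive at both. Then
  \<open>loomis_whitney_eq\<close>, on the line in direction \<open>j\<close> through
  \<open>x\<close>, makes every \<open>g i\<close> positive at \<open>x(j := t)\<close>, and
  \<open>abs_eq_g\<close> turns this into a nonzero value.\<close>

lemma corner:
  assumes "F x \<noteq> 0" "F (x(k := s)) \<noteq> 0" "F (x(k := s, j := t)) \<noteq> 0" "k \<noteq> j"
  shows "F (x(j := t)) \<noteq> 0"
proof -
  have "0 < g k (x(k := s, j := t))" using assms(3) by (rule g_pos)
  then have k: "0 < g k (x(j := t))" using assms(4) by (metis fun_upd_twist g_indep)
  have t: "t \<in> {-N..N}" using supp[OF assms(3), of j] by simp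
  have y: "x i \<in> {-N..N}" for i using supp[OF assms(1), of i] by simp
  have eq: "(\<Sum>y\<in>cyl {-N..N} UNIV x. \<Prod>i\<in>UNIV. g i y powr (1 / (real CARD('a) - 1)))
      = (\<Prod>i\<in>UNIV. sum (g i) (cyl {-N..N} (UNIV - {i}) x) powr (1 / (real CARD('a) - 1)))"
    using sum_prod_g_eq by (simp add: window_eq_cyl[of _ x] sum_g q_def)
  have "0 < g i (x(j := t))" for i
    by (rule loomis_whitney_eq[where y = x, OF _ two_le_card g_nonneg g_indep eq y g_pos[OF assms(1)] t assms(4) k])
      simp
  moreover have "x(j := t) \<in> window N" using t y by (auto simp: window_def)
  ultimately show ?thesis using abs_eq_g by fastforce
qed

text \<open>At \<open>a\<close> and \<open>b\<close> the absolute value already equals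
  \<open>g i x\<close>, so the three-point bound by \<open>2 * g i x\<close> leaves no room for any
  change in between.\<close>

lemma line_const:
  assumes "F (x(i := a)) \<noteq> 0" "F (x(i := b)) \<noteq> 0" "a \<le> c" "c \<le> b"
  shows "F (x(i := c)) = F (x(i := a))"
proof -
  have "\<bar>F (x(i := t))\<bar> = g i x" if "F (x(i := t)) \<noteq> 0" for t
    using abs_eq_g[OF in_window[OF that] g_pos[OF that], of i] by (simp add: g_indep)
  from this[OF assms(1)] this[OF assms(2)] show ?thesis
    using three_point_le_g[of a c b x i] supp[OF assms(1), of i] supp[OF assms(2), of i] assms by simp
qed

definition T :: "'a \<Rightarrow> int set" where "T j = {t. F (x0(j := t)) \<noteq> 0}"

lemma x0_in_T: "x0 j \<in> T j"
  using x0 by (simp add: T_def)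

text \<open>Induction on the set of coordinates in which \<open>y\<close> may differ from
  \<open>x0\<close>. Knowing the support on all lines through \<open>y\<close> is what carries the
  induction: a move in direction \<open>k\<close> keeps the value by \<open>line_const\<close>, and
  keeps the traces on the other lines by \<open>corner\<close>, used both ways.\<close>

lemma on_product:
  assumes "\<And>j. y j \<in> T j"
  shows "F y = F x0 \<and> (\<forall>j t. F (y(j := t)) \<noteq> 0 \<longleftrightarrow> t \<in> T j)"
proof -
  have "F y = F x0 \<and> (\<forall>j t. F (y(j := t)) \<noteq> 0 \<longleftrightarrow> t \<in> T j)"
    if "\<forall>j\<in>J. y j \<in> T j" "\<forall>j. j \<notin> J \<longrightarrow> y j = x0 j" for J y
    using that
  proof (induction J arbitrary: y rule: finite_induct[OF finite])
    case 1
    then have "y = x0" by auto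
    then show ?case unfolding T_def by blast
  next
    case (2 k J)
    define y' where "y' = y(k := x0 k)"
    have "\<forall>j\<in>J. y' j \<in> T j" "\<forall>j. j \<notin> J \<longrightarrow> y' j = x0 j"
      using "2.prems" "2.hyps" by (auto simp: y'_def)
    from "2.IH"[OF this] have IH: "F y' = F x0" "\<And>j t. F (y'(j := t)) \<noteq> 0 \<longleftrightarrow> t \<in> T j"
      by blast+
    have y: "y = y'(k := y k)" and y': "y' = y'(k := x0 k)" by (simp_all add: y'_def)
    have yk: "y k \<in> T k" using "2.prems" by simp
    \<comment> \<open>Two instances, because \<open>line_const\<close> expects its end points in
      increasing order.\<close>
    have "F (y'(k := y k)) = F (y'(k := x0 k))"
      using line_const[of y' k "x0 k" "y k" "y k"] line_const[of y' k "y k" "x0 k" "x0 k"] IH(2) yk x0_in_T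
      by (metis linear order.refl)
    then have Fy: "F y = F x0" using y y' IH(1) by metis
    moreover have "F (y(j := t)) \<noteq> 0 \<longleftrightarrow> t \<in> T j" for j t
    proof (cases "j = k")
      case True
      then show ?thesis using IH(2)[of k t] by (simp add: y'_def)
    next
      case False
      have "F y' \<noteq> 0" "F y \<noteq> 0" using Fy IH(1) x0 by simp_all
      then have "F (y'(j := t)) \<noteq> 0" if "F (y(j := t)) \<noteq> 0"
        using corner[of y' k "y k" j t] that False y by metis
      moreover have "F (y(j := t)) \<noteq> 0" if "F (y'(j := t)) \<noteq> 0"
        using corner[of y k "x0 k" j t] that False \<open>F y' \<noteq> 0\<close> \<open>F y \<noteq> 0\<close> unfolding y'_def by metis
      ultimately show ?thesis using IH(2) by blast
    qed
    ultimately show ?case by blast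
  qed
  from this[of UNIV y] show ?thesis using assms by simp
qed

text \<open>No line meets both the product set \<open>Q\<close> and the rest of the support. Splitting \<open>F\<close> accordingly
  adds up the gradient norms and the \<open>p\<close>-th powers of the norms, so strict subadditivity of
  \<open>t \<mapsto> t powr (1 / p)\<close> rules out a nonempty rest.\<close>

lemma support_product:
  assumes "F x \<noteq> 0"
  shows "x j \<in> T j"
proof (rule ccontr)
  assume xj: "x j \<notin> T j"
  define Q where "Q = {y. \<forall>j. y j \<in> T j}"
  define G where "G y = (if y \<in> Q then F y else 0)" for y
  define H where "H y = (if y \<in> Q then 0 else F y)" for y
  interpret G: lattice_function G N
    using two_le_card supp by unfold_locales (auto simp: G_def split: if_splits)
  interpret H: lattice_function H N
    using two_le_card supp by unfold_locales (auto simp: H_def split: if_splits)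
  have FQ: "y(i := t) \<in> Q" if "y \<in> Q" "F (y(i := t)) \<noteq> 0" for y i t
    using on_product[of y] that by (auto simp: Q_def)
  have "\<bar>F (y(i := y i + 1)) - F y\<bar> = \<bar>G (y(i := y i + 1)) - G y\<bar> + \<bar>H (y(i := y i + 1)) - H y\<bar>" for y i
    using FQ[of y i "y i + 1"] FQ[of "y(i := y i + 1)" i "y i"]
    by (cases "F y = 0"; cases "F (y(i := y i + 1)) = 0") (auto simp: G_def H_def)
  then have grad: "grad_norm N F i = grad_norm N G i + grad_norm N H i" for i
    by (simp add: grad_norm_def sum.distrib)
  have pp: "\<bar>F y\<bar> powr p = \<bar>G y\<bar> powr p + \<bar>H y\<bar> powr p" for y
    by (simp add: G_def H_def)
  define a b where "a = sobolev_norm N G" and "b = sobolev_norm N H"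
  have "G x0 \<noteq> 0" using x0 x0_in_T by (simp add: G_def Q_def)
  moreover have "H x \<noteq> 0" using assms xj by (auto simp: H_def Q_def)
  ultimately have pos: "0 < a" "0 < b" by (auto simp: a_def b_def G.sobolev_norm_pos H.sobolev_norm_pos)
  have "sobolev_norm N F powr p = a powr p + b powr p"
    using sobolev_norm_powr_p G.sobolev_norm_powr_p H.sobolev_norm_powr_p
    by (simp add: a_def b_def pp sum.distrib)
  \<comment> \<open>Splitting off one factor reduces strict superadditivity of the
    \<open>p\<close>-th power to monotonicity of the exponent \<open>p - 1\<close>, which is
    positive.\<close>
  also have "\<dots> = a * a powr (p - 1) + b * b powr (p - 1)"
    using pos by (simp add: powr_mult_base)
  also have "\<dots> < a * (a + b) powr (p - 1) + b * (a + b) powr (p - 1)"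
    using pos p_gt_1 by (intro add_strict_mono mult_strict_left_mono powr_less_mono2) auto
  also have "\<dots> = (a + b) powr p"
    using pos by (simp add: distrib_right[symmetric] powr_mult_base)
  finally have "sobolev_norm N F < a + b"
    using p_pos pos by (meson add_pos_pos less_imp_le not_less powr_mono2)
  also have "\<dots> \<le> (\<Sum>i\<in>UNIV. grad_norm N G i / 2) / real CARD('a) + (\<Sum>i\<in>UNIV. grad_norm N H i / 2) / real CARD('a)"
    unfolding a_def b_def by (intro add_mono G.sobolev H.sobolev)
  also have "\<dots> = sobolev_norm N F"
    by (simp add: extremal grad add_divide_distrib sum.distrib)
  finally show False by simp
qed

lemma ex_box:
  "\<exists>a b. (\<forall>i. a i \<le> b i) \<and> F = (\<lambda>x. if \<forall>i. x i \<in> {a i..b i} then F x0 else 0)"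
proof (intro exI conjI allI)
  have fin: "finite (T i)" for i
  proof (rule finite_subset)
    show "T i \<subseteq> {-N..N}"
    proof
      fix t assume "t \<in> T i"
      then show "t \<in> {-N..N}" using supp[of "x0(i := t)" i] by (simp add: T_def)
    qed
  qed simp
  have ne: "T i \<noteq> {}" for i using x0_in_T by blast
  show "Min (T i) \<le> Max (T i)" for i using fin ne by (meson Max_ge Min_le order.trans x0_in_T)
  \<comment> \<open>By \<open>line_const\<close> the value between the extreme points of
    \<open>T i\<close> is the nonzero value at its minimum, so \<open>T i\<close> has no
    gaps.\<close>
  have T: "t \<in> T i \<longleftrightarrow> t \<in> {Min (T i)..Max (T i)}" for i t
    using line_const[of x0 i "Min (T i)" "Max (T i)" t] Min_in[OF fin ne] Max_in[OF fin ne] fin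
    by (auto simp: T_def)
  have "F = (\<lambda>x. if \<forall>i. x i \<in> T i then F x0 else 0)"
  proof
    fix x
    show "F x = (if \<forall>i. x i \<in> T i then F x0 else 0)"
      using on_product[of x] support_product[of x] by (cases "\<forall>i. x i \<in> T i") (simp, meson)
  qed
  then show "F = (\<lambda>x. if \<forall>i. x i \<in> {Min (T i)..Max (T i)} then F x0 else 0)"
    by (simp only: T)
qed

end


section \<open>Functions constant on a box\<close>

lemma card_box:
  fixes S :: "'n::finite \<Rightarrow> 'b set"
  shows "card {x. \<forall>i. x i \<in> S i} = (\<Prod>i\<in>UNIV. card (S i))"
proof -
  have "{x. \<forall>i. x i \<in> S i} = PiE UNIV S" by (auto simp: PiE_def)
  then show ?thesis by (simp add: card_PiE)
qed

lemma variation_interval: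
  fixes a b N :: int and c :: real
  assumes "a \<le> b" "-N < a" "b < N"
  shows "(\<Sum>t\<in>{-N..N}. \<bar>(if t + 1 \<in> {a..b} then c else 0) - (if t \<in> {a..b} then c else 0)\<bar>) = 2 * \<bar>c\<bar>"
    (is "sum ?h _ = _")
proof -
  \<comment> \<open>The only jumps are the step entering the interval, starting at
    \<open>a - 1\<close>, and the step leaving it, starting at \<open>b\<close>.\<close>
  have "sum ?h {-N..N} = sum ?h {a - 1, b}"
    using assms by (intro sum.mono_neutral_right) auto
  then show ?thesis using assms by simp
qed

text \<open>These explicit values serve both directions of the equality case: they show that an
  extremal box is a cube, and that cubes are extremal.\<close>

locale box_function = lattice_function +
  fixes a b :: "'a \<Rightarrow> int" and c :: real
  assumes a_le_b: "a i \<le> b i" and c: "c \<noteq> 0"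
    and F_eq: "F = (\<lambda>x. if \<forall>i. x i \<in> {a i..b i} then c else 0)"
begin

definition side :: "'a \<Rightarrow> real" where "side i = of_int (b i - a i + 1)"

lemma side_pos: "0 < side i"
  using a_le_b[of i] unfolding side_def by linarith

lemma card_interval: "real (card {a i..b i}) = side i"
  using a_le_b[of i] by (simp add: side_def)

lemma interval_in_window: "-N < a i" "b i < N"
proof -
  have "F a \<noteq> 0" "F b \<noteq> 0" using a_le_b c by (simp_all add: F_eq)
  then show "-N < a i" "b i < N" using supp by blast+
qed

lemma line_variation_box:
  "line_variation N F i x = (if \<forall>j. j \<noteq> i \<longrightarrow> x j \<in> {a j..b j} then 2 * \<bar>c\<bar> else 0)"
proof -
  define P where "P \<longleftrightarrow> (\<forall>j. j \<noteq> i \<longrightarrow> x j \<in> {a j..b j})"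
  define d where "d = (if P then c else 0)"
  have "F (x(i := t)) = (if t \<in> {a i..b i} then d else 0)" for t
    by (auto simp: F_eq d_def P_def)
  then have "line_variation N F i x = 2 * \<bar>d\<bar>"
    using variation_interval[OF a_le_b interval_in_window] by (simp only: line_variation_def)
  then show ?thesis unfolding P_def[symmetric] by (simp add: d_def)
qed

lemma grad_norm_box: "grad_norm N F i = 2 * \<bar>c\<bar> * (\<Prod>j\<in>UNIV - {i}. side j)"
proof -
  let ?C = "cyl {-N..N} (UNIV - {i}) a" and ?P = "\<lambda>x :: 'a \<Rightarrow> int. \<forall>j. j \<noteq> i \<longrightarrow> x j \<in> {a j..b j}"
  have "grad_norm N F i = (\<Sum>x\<in>?C. if ?P x then 2 * \<bar>c\<bar> else 0)"
    by (rule trans[OF grad_norm_eq_sum_line_variation[of N F i a] sum.cong[OF refl line_variation_box]])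
  also have "\<dots> = (\<Sum>x\<in>{x \<in> ?C. ?P x}. 2 * \<bar>c\<bar>)"
    by (rule sum.inter_filter[symmetric]) simp
  \<comment> \<open>The lines crossing the box are indexed by a box whose \<open>i\<close>-th side
    is a single point, so \<open>card_box\<close> counts them.\<close>
  also have "{x \<in> ?C. ?P x} = {x. \<forall>j. x j \<in> (if j = i then {a i} else {a j..b j})}"
  proof (intro set_eqI iffI)
    fix x assume "x \<in> {x. \<forall>j. x j \<in> (if j = i then {a i} else {a j..b j})}"
    then have x: "x j \<in> (if j = i then {a i} else {a j..b j})" for j by simp
    have "x j \<in> {a j..b j} \<and> x j \<in> {-N..N}" if "j \<noteq> i" for j
      using x[of j] interval_in_window[of j] that by simp
    then show "x \<in> {x \<in> ?C. ?P x}" using x[of i] by (auto simp: cyl_def)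
  qed (auto simp: cyl_def)
  also have "(\<Sum>x\<in>\<dots>. 2 * \<bar>c\<bar>) = 2 * \<bar>c\<bar> * (\<Prod>j\<in>UNIV. real (card (if j = i then {a i} else {a j..b j})))"
    by (simp only: sum_constant card_box of_nat_prod mult.commute)
  also have "(\<Prod>j\<in>UNIV. real (card (if j = i then {a i} else {a j..b j}))) = (\<Prod>j\<in>UNIV - {i}. side j)"
    by (subst prod.remove[of _ i]) (auto intro!: prod.cong simp: card_interval simp del: card_atLeastAtMost_int)
  finally show ?thesis .
qed

text \<open>The right-hand side is independent of \<open>i\<close>, so equal gradient norms force
  equal sides.\<close>

lemma grad_norm_box_side: "grad_norm N F i * side i = 2 * \<bar>c\<bar> * (\<Prod>j\<in>UNIV. side j)"
  by (simp add: grad_norm_box prod.remove[of UNIV i side])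

lemma side_eq_if_grad_norm_eq: "grad_norm N F i = grad_norm N F j \<Longrightarrow> side i = side j"
proof -
  assume eq: "grad_norm N F i = grad_norm N F j"
  have "0 < grad_norm N F i" unfolding grad_norm_box using c side_pos by (intro mult_pos_pos prod_pos) auto
  moreover have "grad_norm N F i * side i = grad_norm N F i * side j"
    using grad_norm_box_side[of i] grad_norm_box_side[of j] eq by simp
  ultimately show "side i = side j" by simp
qed

lemma extremal_cube:
  assumes "\<And>i. side i = L"
  shows "sobolev_norm N F = (\<Sum>i\<in>UNIV. grad_norm N F i / 2) / real CARD('a)"
proof -
  have L: "0 < L" using side_pos assms by metis
  have "x \<in> window N" if "\<forall>i. x i \<in> {a i..b i}" for x
    unfolding window_def
  proof (intro CollectI allI)
    show "x i \<in> {-N..N}" for i using that[rule_format, of i] interval_in_window[of i] by simp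
  qed
  then have box: "{x \<in> window N. \<forall>i. x i \<in> {a i..b i}} = {x. \<forall>i. x i \<in> {a i..b i}}" by blast
  have "(\<Sum>x\<in>window N. \<bar>F x\<bar> powr p) = (\<Sum>x\<in>window N. if \<forall>i. x i \<in> {a i..b i} then \<bar>c\<bar> powr p else 0)"
    by (intro sum.cong) (auto simp: F_eq)
  also have "\<dots> = (\<Sum>x\<in>{x \<in> window N. \<forall>i. x i \<in> {a i..b i}}. \<bar>c\<bar> powr p)"
    by (rule sum.inter_filter[symmetric]) simp
  also have "\<dots> = \<bar>c\<bar> powr p * L ^ CARD('a)"
    by (simp only: box sum_constant card_box of_nat_prod card_interval assms mult.commute prod_constant)
  \<comment> \<open>The exponent of \<open>L\<close> is right because \<open>CARD('a)\<close> equals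
    \<open>(CARD('a) - 1) * p\<close>.\<close>
  also have "\<dots> = (\<bar>c\<bar> * L powr (real CARD('a) - 1)) powr p"
    using L two_le_card by (simp add: powr_mult powr_powr p_def powr_realpow)
  finally have "sobolev_norm N F = \<bar>c\<bar> * L powr (real CARD('a) - 1)"
    using p_pos L by (simp add: sobolev_norm_eq powr_powr)
  also have "real CARD('a) - 1 = real (CARD('a) - 1)" using two_le_card by simp
  also have "L powr real (CARD('a) - 1) = L ^ (CARD('a) - 1)" using L by (rule powr_realpow)
  finally show ?thesis by (simp add: grad_norm_box assms card_Diff_singleton)
qed

end

lemma (in extremal_function) ex_cube:
  "\<exists>a b L. (\<forall>i. a i \<le> b i) \<and> (\<forall>i. b i - a i = L) \<and> F = (\<lambda>x. if \<forall>i. x i \<in> {a i..b i} then F x0 else 0)"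
proof -
  obtain a b where ab: "\<And>i. a i \<le> b i" "F = (\<lambda>x. if \<forall>i. x i \<in> {a i..b i} then F x0 else 0)"
    using ex_box by blast
  interpret box_function F N a b "F x0"
    using ab x0 by unfold_locales auto
  have "side i = side j" for i j by (rule side_eq_if_grad_norm_eq[OF grad_norm_const])
  then have "b i - a i = b j - a j" for i j by (simp add: side_def del: of_int_diff)
  \<comment> \<open>Here \<open>undefined\<close> just names some direction, whose length serves as
    the common \<open>L\<close>.\<close>
  then have "\<forall>i. b i - a i = b undefined - a undefined" by blast
  then show ?thesis using ab by blast
qed

section \<open>Transfer to vectors and infinite sums\<close>

lemma infsum_finite_support:
  assumes "finite A" "\<And>x. x \<notin> A \<Longrightarrow> h x = 0"
  shows "infsum h UNIV = sum h A"
proof -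
  have "infsum h UNIV = infsum h A" by (rule infsum_cong_neutral) (use assms in auto)
  then show ?thesis using assms(1) by simp
qed

lemma infsum_vec_lambda:
  fixes h :: "'b ^ 'n::finite \<Rightarrow> real"
  shows "infsum h UNIV = (\<Sum>\<^sub>\<infinity>x. h (vec_lambda x))"
proof (rule infsum_reindex_bij_betw[symmetric])
  show "bij_betw vec_lambda UNIV (UNIV :: ('b ^ 'n) set)"
    by (rule bij_betw_byWitness[of _ vec_nth]) auto
qed

lemma vec_lambda_add_axis: "vec_lambda x + axis i (1 :: int) = vec_lambda (x(i := x i + 1))"
  by (simp add: vec_eq_iff axis_def)

lemma
  fixes f :: "int ^ 'n::finite \<Rightarrow> real"
  assumes "lattice_function (\<lambda>x. f (vec_lambda x)) N"
  shows lp_norm_eq_sobolev_norm: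
      "lp_norm (real CARD('n) / (real CARD('n) - 1)) f = sobolev_norm N (\<lambda>x. f (vec_lambda x))"
    and infsum_partial_eq_grad_norm:
      "(\<Sum>\<^sub>\<infinity>z. \<bar>f (z + axis i 1) - f z\<bar>) = grad_norm N (\<lambda>x. f (vec_lambda x)) i"
proof -
  interpret lattice_function "\<lambda>x. f (vec_lambda x)" N by fact
  show "lp_norm (real CARD('n) / (real CARD('n) - 1)) f = sobolev_norm N (\<lambda>x. f (vec_lambda x))"
    unfolding lp_norm_def sobolev_norm_def infsum_vec_lambda
    by (subst infsum_finite_support[OF finite_window]) (use in_window in auto)
  \<comment> \<open>The strict lower bound matters: \<open>x i + 1 > -N\<close> gives
    \<open>x i \<ge> -N\<close>, so a point outside the window cannot step into the support.\<close>
  have "f (vec_lambda x) = 0 \<and> f (vec_lambda (x(i := x i + 1))) = 0" if x: "x \<notin> window N" for x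
  proof -
    obtain k where k: "x k \<notin> {-N..N}" using x by (auto simp: window_def)
    have "f (vec_lambda (x(i := x i + 1))) = 0"
    proof (rule ccontr)
      assume "f (vec_lambda (x(i := x i + 1))) \<noteq> 0"
      from supp[OF this, of k] k show False by (auto split: if_splits)
    qed
    then show ?thesis using in_window x by blast
  qed
  then show "(\<Sum>\<^sub>\<infinity>z. \<bar>f (z + axis i 1) - f z\<bar>) = grad_norm N (\<lambda>x. f (vec_lambda x)) i"
    unfolding grad_norm_def infsum_vec_lambda vec_lambda_add_axis
    by (intro infsum_finite_support) auto
qed

lemma ex_lattice_function:
  fixes f :: "int ^ 'n::finite \<Rightarrow> real"
  assumes "2 \<le> CARD('n)" "f \<in> C0"
  shows "\<exists>N. lattice_function (\<lambda>x. f (vec_lambda x)) N"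
proof -
  define A where "A = (\<lambda>(z, i). \<bar>z $ i\<bar>) ` ({z. f z \<noteq> 0} \<times> UNIV)"
  have A: "finite A" using assms(2) by (simp add: A_def C0_def)
  \<comment> \<open>Adding one makes the support bounds strict; inserting \<open>0\<close> keeps the
    maximum meaningful when \<open>f\<close> is zero.\<close>
  define N where "N = Max (insert 0 A) + 1"
  have "lattice_function (\<lambda>x. f (vec_lambda x)) N"
  proof
    fix x i assume "f (vec_lambda x) \<noteq> 0"
    then have "\<bar>x i\<bar> \<in> A" by (force simp: A_def)
    then have "\<bar>x i\<bar> \<le> Max (insert 0 A)" using A by (intro Max_ge) auto
    then show "- N < x i \<and> x i < N" by (auto simp: N_def)
  qed fact
  then show ?thesis ..
qed

theorem corollary1p1:
  fixes f :: "int ^ 'n::finite \<Rightarrow> real"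
  assumes "2 \<le> CARD('n)"
    and "f \<in> C0"
  shows "lp_norm (real CARD('n) / (real CARD('n) - 1)) f
           \<le> 1 / (2 * real CARD('n)) * differential_l1_norm f
       \<and> (lp_norm (real CARD('n) / (real CARD('n) - 1)) f
             = 1 / (2 * real CARD('n)) * differential_l1_norm f
           \<longleftrightarrow> (\<exists>(c::real) Q. is_cube Q \<and> f = (\<lambda>z. c * indicat_real Q z)))"
proof -
  define F where "F = (\<lambda>x. f (vec_lambda x))"
  obtain N where N: "lattice_function F N"
    using ex_lattice_function[OF assms] by (auto simp: F_def)
  interpret lattice_function F N by fact
  have f: "f z = F (vec_nth z)" for z by (simp add: F_def)
  have lp: "lp_norm (real CARD('n) / (real CARD('n) - 1)) f = sobolev_norm N F"
    using lp_norm_eq_sobolev_norm N by (simp add: F_def)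
  have grad: "1 / (2 * real CARD('n)) * differential_l1_norm f
      = (\<Sum>i\<in>UNIV. grad_norm N F i / 2) / real CARD('n)"
    unfolding differential_l1_norm_eq_sum_partial[OF assms(2)]
      infsum_partial_eq_grad_norm[OF N[unfolded F_def], folded F_def] sum_divide_distrib[symmetric]
    by simp
  have "\<exists>c Q. is_cube Q \<and> f = (\<lambda>z. c * indicat_real Q z)"
    if "sobolev_norm N F = (\<Sum>i\<in>UNIV. grad_norm N F i / 2) / real CARD('n)"
  proof (cases "\<exists>x0. F x0 \<noteq> 0")
    case True
    then obtain x0 where "F x0 \<noteq> 0" ..
    then interpret extremal_function F N x0 using that by unfold_locales
    obtain a b L where ab: "\<forall>i. a i \<le> b i" "\<forall>i. b i - a i = L"
      and F: "F = (\<lambda>x. if \<forall>i. x i \<in> {a i..b i} then F x0 else 0)"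
      using ex_cube by blast
    have "is_cube {z :: int ^ 'n. \<forall>i. z $ i \<in> {a i..b i}}"
      unfolding is_cube_def using ab
      by (intro exI[of _ "vec_lambda a"] exI[of _ "vec_lambda b"]) simp
    moreover have "f = (\<lambda>z. F x0 * indicat_real {z. \<forall>i. z $ i \<in> {a i..b i}} z)"
      by (rule ext) (subst f, subst F, simp add: indicator_def)
    ultimately show ?thesis by blast
  next
    case False
    \<comment> \<open>The zero function is written as \<open>0\<close> times the indicator of a
      one-point cube.\<close>
    have "is_cube {z :: int ^ 'n. \<forall>i. z $ i \<in> {0..0}}"
      unfolding is_cube_def by (intro exI[of _ 0]) simp
    moreover have "f = (\<lambda>z. 0 * indicat_real {z. \<forall>i. z $ i \<in> {0..0}} z)"
      using False f by auto
    ultimately show ?thesis by blast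
  qed
  moreover have "sobolev_norm N F = (\<Sum>i\<in>UNIV. grad_norm N F i / 2) / real CARD('n)"
    if Q: "is_cube Q" and fQ: "f = (\<lambda>z. c * indicat_real Q z)" for c Q
  proof (cases "c = 0")
    case True
    then have "F = (\<lambda>_. 0)" using fQ by (simp add: F_def)
    then show ?thesis by (simp add: sobolev_norm_def grad_norm_def)
  next
    case False
    obtain a b :: "int ^ 'n" where ab: "\<And>i. a $ i \<le> b $ i" "\<And>i j. \<bar>b $ i - a $ i\<bar> = \<bar>b $ j - a $ j\<bar>"
      "Q = {z. \<forall>i. z $ i \<in> {a $ i..b $ i}}"
      using Q unfolding is_cube_def by blast
    interpret box_function F N "vec_nth a" "vec_nth b" c
      using ab False by unfold_locales (auto simp: F_def fQ indicator_def)
    have "b $ i - a $ i = b $ j - a $ j" for i j using ab(1)[of i] ab(1)[of j] ab(2)[of i j] by simp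
    then have "side i = side undefined" for i unfolding side_def by metis
    then show ?thesis by (rule extremal_cube)
  qed
  ultimately show ?thesis unfolding lp grad using sobolev by blast
qed

end
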